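(* Let $q$ be a prime power, let $n\geq 2$ be an integer and let $d$ be an integer with $0\leq d\leq \lfloor n^2/4\rfloor$. The number of distance vectors in $\mathcal{D}(n)$ corresponding to the flag distance value $d$, i.e. the cardinality of $\mathcal{D}(d,n)$, equals the number $T(n,d)$ of Motzkin paths $p\in\mathcal{M}_n$ such that $A(p)=d$.
   Context: Let $\mathbb{F}_q$ be the finite field with $q$ elements. A full flag on $\mathbb{F}_q^n$ is a sequence $\mathcal{F}=(\mathcal{F}_1,\dots,\mathcal{F}_{n-1})$ of $\mathbb{F}_q$-subspaces of $\mathbb{F}_q^n$ with $\mathcal{F}_1\subsetneq\cdots\subsetneq\mathcal{F}_{n-1}$ and $\dim \mathcal{F}_i=i$ for every $i$; the set of all full flags is the full flag variety $\mathcal{F}_q(n)$. For subspaces $\mathcal{U},\mathcal{V}$ of the same dimension $k$, the injection distance is $d_I(\mathcal{U},\mathcal{V})=k-\dim(\mathcal{U}\cap\mathcal{V})$. The distance vector of $\mathcal{F},\mathcal{F}'\in\mathcal{F}_q(n)$ is $\mathbf{d}(\mathcal{F},\mathcal{F}')=(d_I(\mathcal{F}_1,\mathcal{F}'_1),\dots,d_I(\mathcal{F}_{n-1},\mathcal{F}'_{n-1}))\in\mathbb{Z}^{n-1}$; the flag distance $d_f(\mathcal{F},\mathcal{F}')=\sum_{i=1}^{n-1} d_I(\mathcal{F}_i,\mathcal{F}'_i)$ is the sum of its components. Put $\mathcal{D}(n)=\{\mathbf{d}(\mathcal{F},\mathcal{F}') \mid \mathcal{F},\mathcal{F}'\in\mathcal{F}_q(n)\}$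 and $\mathcal{D}(d,n)=\{\mathbf{d}(\mathcal{F},\mathcal{F}') \mid \mathcal{F},\mathcal{F}'\in\mathcal{F}_q(n),\ d_f(\mathcal{F},\mathcal{F}')=d\}$ (pairs with $\mathcal{F}=\mathcal{F}'$ are allowed). The maximum possible flag distance in $\mathcal{F}_q(n)$ is $\lfloor n^2/4\rfloor$. A Motzkin path of length $n$ is a lattice path in $\mathbb{Z}^2$ from $(0,0)$ to $(n,0)$ with steps $U=(1,1)$, $D=(1,-1)$, $H=(1,0)$ that never runs below the $x$-axis; $\mathcal{M}_n$ is the set of these. The area $A(p)$ of a Motzkin path $p$ is the area of the region above the $x$-axis and below $p$. $T(n,k)$ denotes the number of Motzkin paths of length $n$ and area $k$ (sequence A129181 in the OEIS). *)

theory Defs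
  imports "HOL-Analysis.Analysis" "HOL-Number_Theory.Prime_Powers"
begin

text \<open>
  The space \<open>\<bbbF>\<^sub>q\<^sup>n\<close> is rendered as \<open>'a ^ 'n\<close> with \<open>'a :: {field, finite}\<close>, \<open>CARD('a) = q\<close> and
  \<open>CARD('n) = n\<close>. The library interpretation \<open>vec\<close> provides subspaces and dimension over an
  arbitrary field.
\<close>

text \<open>
  A flag \<open>(F\<^sub>1, \<dots>, F\<^sub>n\<^sub>-\<^sub>1)\<close> is the list of its subspaces; list positions start at 0, so
  \<open>F\<^sub>i\<close> is \<open>F ! (i - 1)\<close>.
\<close>

definition full_flags :: "('a::{field,finite} ^ 'n) set list set" where
  "full_flags = {F. length F = CARD('n) - 1 \<and> sorted_wrt (\<subset>) F \<and>
     (\<forall>i\<in>{1..<CARD('n)}. vec.subspace (F ! (i - 1)) \<and> vec.dim (F ! (i - 1)) = i)}"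

text \<open>Meaningful only for subspaces of the same dimension, as in a pair of flags.\<close>

definition injection_distance ::
    "('a::{field,finite} ^ 'n) set \<Rightarrow> ('a ^ 'n) set \<Rightarrow> int" where
  "injection_distance U V = int (vec.dim U) - int (vec.dim (U \<inter> V))"

definition distance_vector ::
    "('a::{field,finite} ^ 'n) set list \<Rightarrow> ('a ^ 'n) set list \<Rightarrow> int list" where
  "distance_vector F F' = map2 injection_distance F F'"

definition flag_distance ::
    "('a::{field,finite} ^ 'n) set list \<Rightarrow> ('a ^ 'n) set list \<Rightarrow> int" where
  "flag_distance F F' = sum_list (distance_vector F F')"

text \<open>
  The set \<open>\<D>(d, n)\<close>. Its elements are integer lists, whose type does not determine the ambient
  space; hence the type argument.
\<close>

definition distance_vectors ::
    "('a::{field,finite} ^ 'n) itself \<Rightarrow> int \<Rightarrow> int list set" where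
  "distance_vectors _ d = {distance_vector F F' | F F' :: ('a ^ 'n) set list.
     F \<in> full_flags \<and> F' \<in> full_flags \<and> flag_distance F F' = d}"

text \<open>
  A lattice path starting at \<open>(0, 0)\<close> is the list of its steps, as vectors in \<open>\<int>\<^sup>2\<close>;
  \<open>path_vertex p i\<close> is the point reached after \<open>i\<close> steps.
\<close>

definition path_vertex :: "(int \<times> int) list \<Rightarrow> nat \<Rightarrow> int \<times> int" where
  "path_vertex p i = sum_list (take i p)"

definition motzkin_paths :: "nat \<Rightarrow> (int \<times> int) list set" where
  "motzkin_paths n = {p. set p \<subseteq> {(1, 1), (1, -1), (1, 0)} \<and>
     path_vertex p (length p) = (int n, 0) \<and>
     (\<forall>i\<le>length p. snd (path_vertex p i) \<ge> 0)}"

definition real_vertex :: "(int \<times> int) list \<Rightarrow> nat \<Rightarrow> real \<times> real" where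
  "real_vertex p i = map_prod real_of_int real_of_int (path_vertex p i)"

definition path_curve :: "(int \<times> int) list \<Rightarrow> (real \<times> real) set" where
  "path_curve p = (\<Union>i<length p. closed_segment (real_vertex p i) (real_vertex p (Suc i)))"

definition path_area :: "(int \<times> int) list \<Rightarrow> real" where
  "path_area p = measure lborel {(x, y). 0 \<le> y \<and> (\<exists>z. y \<le> z \<and> (x, z) \<in> path_curve p)}"

definition motzkin_count :: "nat \<Rightarrow> nat \<Rightarrow> nat" where
  "motzkin_count n k = card {p \<in> motzkin_paths n. path_area p = real k}"

end

theory Submission
  imports Defs
begin

text \<open>
  The distance vectors are exactly the sequences of interior heights of Motzkin paths. By the
  dimension formula, \<open>dim (F\<^sub>i \<inter> F'\<^sub>i)\<close> grows by 0, 1 or 2 when \<open>i\<close> grows by one, so the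
  injection distances change by at most 1, and they vanish for \<open>i = 0\<close> and \<open>i = n\<close>. Conversely,
  every height sequence is realized by two flags of coordinate subspaces, whose index sets grow
  greedily: a step up adds two different fresh indices, a horizontal step adds the same fresh
  index to both sets, and a step down adds to each set an index that only the other one contains.
  The area of a path is a sum of trapezoids of width 1, hence the sum of its heights, which is the
  flag distance.
\<close>

section \<open>Motzkin paths and their height sequences\<close>

text \<open>Values beyond \<open>n\<close> are left free, so different members can describe the same
  path. Only the interior lists \<open>map h [1..<n]\<close> are counted later.\<close>

definition motzkin_heights :: "nat \<Rightarrow> (nat \<Rightarrow> int) set" where
  "motzkin_heights n = {h. h 0 = 0 \<and> h n = 0 \<and> (\<forall>i\<le>n. 0 \<le> h i) \<and>
     (\<forall>i<n. \<bar>h (Suc i) - h i\<bar> \<le> 1)}"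

lemma path_vertex_0: "path_vertex p 0 = (0, 0)"
  by (simp add: path_vertex_def zero_prod_def)

lemma path_vertex_Suc:
  "i < length p \<Longrightarrow> path_vertex p (Suc i) = path_vertex p i + p ! i"
  by (simp add: path_vertex_def take_Suc_conv_app_nth)

lemma fst_path_vertex:
  assumes "set p \<subseteq> {(1, 1), (1, -1), (1, 0)}" and "i \<le> length p"
  shows "fst (path_vertex p i) = int i"
  using assms(2)
proof (induction i)
  case 0
  then show ?case by (simp add: path_vertex_0)
next
  case (Suc i)
  then have "p ! i \<in> set p" by simp
  with assms(1) have "fst (p ! i) = 1" by auto
  with Suc show ?case by (simp add: path_vertex_Suc)
qed

text \<open>Every step advances the first coordinate by 1, so the endpoint \<open>(n, 0)\<close>
  fixes the number of steps.\<close>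

lemma motzkin_paths_length:
  assumes "p \<in> motzkin_paths n"
  shows "length p = n"
proof -
  have "fst (path_vertex p (length p)) = int (length p)"
    using assms by (intro fst_path_vertex) (auto simp: motzkin_paths_def)
  then show ?thesis using assms by (simp add: motzkin_paths_def)
qed

lemma motzkin_paths_heights:
  assumes "p \<in> motzkin_paths n"
  shows "(\<lambda>i. snd (path_vertex p i)) \<in> motzkin_heights n"
proof -
  have len: "length p = n" using assms by (rule motzkin_paths_length)
  have "\<bar>snd (path_vertex p (Suc i)) - snd (path_vertex p i)\<bar> \<le> 1" if "i < n" for i
  proof -
    have "p ! i \<in> set p" using that len by simp
    then have "p ! i \<in> {(1, 1), (1, -1), (1, 0)}" using assms by (auto simp: motzkin_paths_def)
    then show ?thesis using that len by (auto simp: path_vertex_Suc)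
  qed
  then show ?thesis
    using assms len by (auto simp: motzkin_heights_def motzkin_paths_def path_vertex_0)
qed

text \<open>First coordinates are determined by the index and both end heights are 0, so interior
  heights fix all vertices. Steps are differences of consecutive vertices.\<close>

lemma motzkin_paths_eqI:
  assumes p: "p \<in> motzkin_paths n" and r: "r \<in> motzkin_paths n"
    and eq: "\<And>i. 0 < i \<Longrightarrow> i < n \<Longrightarrow> snd (path_vertex p i) = snd (path_vertex r i)"
  shows "p = r"
proof -
  have len: "length p = n" "length r = n"
    using p r by (auto dest: motzkin_paths_length)
  have vert: "path_vertex p i = path_vertex r i" if "i \<le> n" for i
  proof (rule prod_eqI)
    show "fst (path_vertex p i) = fst (path_vertex r i)"
      using p r that len by (simp add: motzkin_paths_def fst_path_vertex)
    show "snd (path_vertex p i) = snd (path_vertex r i)"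
    proof (cases "i = 0 \<or> i = n")
      case True
      then show ?thesis
        using p r len by (auto simp: motzkin_paths_def path_vertex_0)
    qed (use eq that in auto)
  qed
  show ?thesis
  proof (rule nth_equalityI)
    fix i assume "i < length p"
    then show "p ! i = r ! i"
      using vert[of i] vert[of "Suc i"] len path_vertex_Suc[of i p] path_vertex_Suc[of i r]
      by simp
  qed (simp add: len)
qed

lemma motzkin_heights_path:
  assumes h: "h \<in> motzkin_heights n"
  obtains p where "p \<in> motzkin_paths n" and "\<And>i. i \<le> n \<Longrightarrow> snd (path_vertex p i) = h i"
proof
  define p where "p = map (\<lambda>i. (1::int, h (Suc i) - h i)) [0..<n]"
  have vert: "path_vertex p i = (int i, h i)" if "i \<le> n" for i
    using that
  proof (induction i)
    case 0
    then show ?case using h by (simp add: path_vertex_0 motzkin_heights_def)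
  qed (simp add: path_vertex_Suc p_def)
  have "set p \<subseteq> {(1, 1), (1, -1), (1, 0)}"
  proof -
    have "h (Suc i) - h i \<in> {1, -1, 0}" if "i < n" for i
    proof -
      have "\<bar>h (Suc i) - h i\<bar> \<le> 1" using h that by (simp add: motzkin_heights_def)
      then show ?thesis by auto
    qed
    then show ?thesis by (fastforce simp: p_def)
  qed
  moreover have "length p = n" by (simp add: p_def)
  ultimately show "p \<in> motzkin_paths n"
    using h vert by (simp add: motzkin_paths_def motzkin_heights_def)
  show "snd (path_vertex p i) = h i" if "i \<le> n" for i using vert that by simp
qed

section \<open>Area of Motzkin paths and counting by area\<close>

text \<open>The upper bound for \<open>y\<close> interpolates linearly between height
  \<open>u\<close> at \<open>a\<close> and height \<open>v\<close> at \<open>a + 1\<close>.\<close>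

definition trapezoid :: "real \<Rightarrow> real \<Rightarrow> real \<Rightarrow> (real \<times> real) set" where
  "trapezoid a u v = {(x, y). x \<in> {a..a+1} \<and> y \<in> {0..u + (x - a) * (v - u)}}"

text \<open>The segment has width 1, so its parameter at abscissa \<open>x\<close> must be
  \<open>x - a\<close>, and this determines the height \<open>z\<close>.\<close>

lemma subgraph_unit_segment:
  "{(x, y). 0 \<le> y \<and> (\<exists>z. y \<le> z \<and> (x, z) \<in> closed_segment (a, u) (a + 1, v))} = trapezoid a u v"
proof -
  have "(x, z) \<in> closed_segment (a, u) (a + 1, v) \<longleftrightarrow> x \<in> {a..a+1} \<and> z = u + (x - a) * (v - u)"
    for x z :: real
  proof -
    have "(x, z) \<in> closed_segment (a, u) (a + 1, v) \<longleftrightarrow>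
        (\<exists>t. 0 \<le> t \<and> t \<le> 1 \<and> t = x - a \<and> z = u + t * (v - u))"
      by (auto simp: in_segment algebra_simps)
    then show ?thesis by auto
  qed
  then show ?thesis by (auto simp: trapezoid_def)
qed

lemma closed_trapezoid: "closed (trapezoid a u v)"
proof -
  have "trapezoid a u v = {p. a \<le> fst p} \<inter> {p. fst p \<le> a + 1} \<inter> {p. 0 \<le> snd p} \<inter>
      {p. snd p \<le> u + (fst p - a) * (v - u)}"
    by (auto simp: trapezoid_def)
  also have "closed \<dots>"
    by (intro closed_Int closed_Collect_le continuous_intros)
  finally show ?thesis .
qed

text \<open>By Fubini the measure is the integral of the lengths of the vertical slices, which the
  fundamental theorem of calculus evaluates.\<close>

lemma
  assumes "0 \<le> u" and "0 \<le> v"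
  shows trapezoid_lmeasurable: "trapezoid a u v \<in> lmeasurable"
    and measure_trapezoid: "measure lebesgue (trapezoid a u v) = (u + v) / 2"
proof -
  let ?f = "\<lambda>x. u + (x - a) * (v - u)"
  \<comment> \<open>An antiderivative of \<open>?f\<close> that vanishes at
    \<open>a\<close>.\<close>
  let ?F = "\<lambda>x. u * (x - a) + (x - a)\<^sup>2 / 2 * (v - u)"
  have pos: "0 \<le> ?f x" if "x \<in> {a..a+1}" for x
  proof -
    \<comment> \<open>On the unit interval \<open>?f x\<close> is a convex combination of
      \<open>u\<close> and \<open>v\<close>.\<close>
    have "0 \<le> (1 - (x - a)) * u + (x - a) * v" using that assms by simp
    then show ?thesis by (simp add: algebra_simps)
  qed
  have borel: "trapezoid a u v \<in> sets borel" using closed_trapezoid by simp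
  then have "trapezoid a u v \<in> sets (lborel \<Otimes>\<^sub>M lborel)"
    by (subst lborel_prod) simp
  then have "emeasure lborel (trapezoid a u v) =
      (\<integral>\<^sup>+x. emeasure lborel (Pair x -` trapezoid a u v) \<partial>lborel)"
    by (subst lborel_prod[symmetric], intro lborel.emeasure_pair_measure_alt)
  also have "\<dots> = (\<integral>\<^sup>+x. ennreal (?f x) * indicator {a..a+1} x \<partial>lborel)"
  proof (rule nn_integral_cong)
    fix x :: real
    have "Pair x -` trapezoid a u v = (if x \<in> {a..a+1} then {0..?f x} else {})"
      by (auto simp: trapezoid_def)
    then show "emeasure lborel (Pair x -` trapezoid a u v) = ennreal (?f x) * indicator {a..a+1} x"
      using pos[of x] by (simp add: emeasure_lborel_Icc)
  qed
  also have "\<dots> = ?F (a + 1) - ?F a"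
  proof (rule nn_integral_FTC_Icc)
    show "?f \<in> borel_measurable borel" by measurable
    show "(?F has_real_derivative ?f x) (at x)" for x
      by (auto intro!: derivative_eq_intros simp: field_simps)
  qed (use pos in auto)
  also have "?F (a + 1) - ?F a = (u + v) / 2" by (simp add: field_simps)
  finally have em: "emeasure lebesgue (trapezoid a u v) = ennreal ((u + v) / 2)"
    using borel by simp
  then show "trapezoid a u v \<in> lmeasurable"
    using borel by (intro fmeasurableI) auto
  show "measure lebesgue (trapezoid a u v) = (u + v) / 2"
    using em assms by (simp add: measure_def)
qed

text \<open>A common point must have first coordinate \<open>b\<close>, so the overlap lies on a
  vertical line.\<close>

lemma negligible_trapezoid_Int:
  assumes "a + 1 \<le> b"
  shows "negligible (trapezoid a u v \<inter> trapezoid b w z)"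
proof (rule negligible_subset)
  have "negligible {p :: real \<times> real. p \<bullet> (1, 0) = b}"
    by (rule negligible_standard_hyperplane) (simp add: Basis_prod_def)
  then show "negligible {p :: real \<times> real. fst p = b}"
    by (simp add: inner_prod_def)
qed (use assms in \<open>auto simp: trapezoid_def\<close>)

text \<open>Each interior height occurs twice, as the right end of one interval and the left end of
  the next; the two outer heights vanish.\<close>

lemma sum_int_consecutive:
  fixes h :: "nat \<Rightarrow> int"
  assumes "h 0 = 0" and "h n = 0"
  shows "(\<Sum>i<n. h i + h (Suc i)) = 2 * (\<Sum>i=1..<n. h i)"
proof (cases n)
  case (Suc m)
  have "(\<Sum>i<n. h (Suc i)) = (\<Sum>i<m. h (Suc i))" using assms Suc by simp
  moreover have "(\<Sum>i<n. h i) = (\<Sum>i<m. h (Suc i))"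
    unfolding Suc sum.lessThan_Suc_shift using assms by simp
  moreover have "(\<Sum>i=1..<n. h i) = (\<Sum>i<m. h (Suc i))"
    unfolding Suc One_nat_def sum.shift_bounds_Suc_ivl atLeast0LessThan ..
  ultimately show ?thesis by (simp add: sum.distrib)
qed simp

lemma path_area_motzkin:
  assumes p: "p \<in> motzkin_paths n"
  shows "path_area p = real_of_int (\<Sum>i=1..<n. snd (path_vertex p i))"
proof -
  let ?h = "\<lambda>i. snd (path_vertex p i)"
  let ?T = "\<lambda>i. trapezoid (real i) (of_int (?h i)) (of_int (?h (Suc i)))"
  have len: "length p = n" using p by (rule motzkin_paths_length)
  have H: "?h 0 = 0" "?h n = 0" "\<And>i. i \<le> n \<Longrightarrow> 0 \<le> ?h i"
    using motzkin_paths_heights[OF p] by (auto simp: motzkin_heights_def)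
  have vert: "real_vertex p i = (real i, of_int (?h i))" if "i \<le> n" for i
  proof -
    have "fst (path_vertex p i) = int i"
      using p that len by (intro fst_path_vertex) (auto simp: motzkin_paths_def)
    then show ?thesis by (simp add: real_vertex_def map_prod_def case_prod_beta)
  qed
  have "{(x, y). 0 \<le> y \<and> (\<exists>z. y \<le> z \<and> (x, z) \<in> path_curve p)} =
      (\<Union>i<n. {(x, y). 0 \<le> y \<and>
        (\<exists>z. y \<le> z \<and> (x, z) \<in> closed_segment (real_vertex p i) (real_vertex p (Suc i)))})"
    by (auto simp: path_curve_def len)
  also have "\<dots> = (\<Union>i<n. ?T i)"
    by (intro SUP_cong refl)
      (simp add: vert subgraph_unit_segment[symmetric] add.commute)
  finally have "path_area p = measure lborel (\<Union>i<n. ?T i)" by (simp add: path_area_def)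
  \<comment> \<open>The finite union is closed, hence Borel, so both measures agree on it. The
    additivity up to negligible overlaps used next is stated for \<open>lebesgue\<close>.\<close>
  also have "\<dots> = measure lebesgue (\<Union>i<n. ?T i)"
    by (intro measure_completion[symmetric])
      (auto intro!: borel_closed closed_UN closed_trapezoid)
  also have "\<dots> = (\<Sum>i<n. measure lebesgue (?T i))"
  proof (rule measure_negligible_finite_Union_image)
    show "?T i \<in> lmeasurable" if "i \<in> {..<n}" for i
      using that H by (intro trapezoid_lmeasurable) auto
    have "negligible (?T i \<inter> ?T j)" if "i < j" for i j
      using that by (intro negligible_trapezoid_Int) auto
    then show "pairwise (\<lambda>i j. negligible (?T i \<inter> ?T j)) {..<n}"
      unfolding pairwise_def by (metis Int_commute linorder_neqE_nat)
  qed simp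
  also have "\<dots> = (\<Sum>i<n. (of_int (?h i) + of_int (?h (Suc i))) / 2)"
    using H by (intro sum.cong refl measure_trapezoid) auto
  also have "\<dots> = real_of_int (\<Sum>i<n. ?h i + ?h (Suc i)) / 2"
    by (simp add: sum_divide_distrib)
  also have "\<dots> = real_of_int (\<Sum>i=1..<n. ?h i)"
    by (subst sum_int_consecutive) (use H in auto)
  finally show ?thesis .
qed

text \<open>Reading off the interior heights is a bijection under which the area becomes the sum of
  the list.\<close>

lemma motzkin_count_eq_card_heights:
  "motzkin_count n d = card {map h [1..<n] | h. h \<in> motzkin_heights n \<and> (\<Sum>i=1..<n. h i) = int d}"
proof -
  let ?f = "\<lambda>p. map (\<lambda>i. snd (path_vertex p i)) [1..<n]"
  let ?P = "{p \<in> motzkin_paths n. path_area p = real d}"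
  let ?L = "{map h [1..<n] | h. h \<in> motzkin_heights n \<and> (\<Sum>i=1..<n. h i) = int d}"
  have area: "path_area p = real d \<longleftrightarrow> (\<Sum>i=1..<n. snd (path_vertex p i)) = int d"
    if "p \<in> motzkin_paths n" for p
    using path_area_motzkin[OF that] by (metis of_int_eq_iff of_int_of_nat_eq)
  have "bij_betw ?f ?P ?L"
  proof (rule bij_betw_imageI)
    show "inj_on ?f ?P"
      by (rule inj_onI, rule motzkin_paths_eqI[where n = n]) auto
    show "?f ` ?P = ?L"
    proof (intro equalityI subsetI)
      fix l assume "l \<in> ?f ` ?P"
      then obtain p where "p \<in> ?P" and "l = ?f p" by blast
      then show "l \<in> ?L"
        using motzkin_paths_heights area by blast
    next
      fix l assume "l \<in> ?L"
      then obtain h where h: "h \<in> motzkin_heights n" "(\<Sum>i=1..<n. h i) = int d" "l = map h [1..<n]"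
        by blast
      from h(1) obtain p where p: "p \<in> motzkin_paths n" "\<And>i. i \<le> n \<Longrightarrow> snd (path_vertex p i) = h i"
        by (rule motzkin_heights_path) blast
      have "?f p = l" using p(2) h(3) by simp
      moreover have "path_area p = real d"
        using area[OF p(1)] h(2) p(2) by simp
      ultimately show "l \<in> ?f ` ?P" using p(1) by blast
    qed
  qed
  then show ?thesis unfolding motzkin_count_def by (rule bij_betw_same_card)
qed

section \<open>Distance vectors are height sequences\<close>

text \<open>The sum of \<open>A\<close> and \<open>B \<inter> C\<close> stays inside
  \<open>B\<close>, so the dimension formula bounds what the intersection with \<open>C\<close>
  gains when \<open>A\<close> grows to \<open>B\<close>.\<close>

lemma vec_dim_Int_le:
  fixes A B C :: "('a::field ^ 'n) set"
  assumes "vec.subspace A" "vec.subspace B" "vec.subspace C" and "A \<subseteq> B"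
  shows "vec.dim (B \<inter> C) + vec.dim A \<le> vec.dim (A \<inter> C) + vec.dim B"
proof -
  let ?S = "{x + y | x y. x \<in> A \<and> y \<in> B \<inter> C}"
  have "vec.dim ?S + vec.dim (A \<inter> (B \<inter> C)) = vec.dim A + vec.dim (B \<inter> C)"
    using assms by (intro vec.dim_sums_Int vec.subspace_inter)
  moreover have "A \<inter> (B \<inter> C) = A \<inter> C" using assms(4) by auto
  moreover have "vec.dim ?S \<le> vec.dim B"
    using assms by (intro vec.dim_subset) (auto intro: vec.subspace_add)
  ultimately show ?thesis by simp
qed

text \<open>Adding the zero space and the whole space at indices 0 and \<open>CARD('n)\<close> lets
  the first and last steps be treated like all others.\<close>

lemma full_flag_extend:
  fixes F :: "('a::{field,finite} ^ 'n) set list"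
  assumes F: "F \<in> full_flags"
  obtains G where "\<And>i. i \<le> CARD('n) \<Longrightarrow> vec.subspace (G i) \<and> vec.dim (G i) = i"
    and "\<And>i. i < CARD('n) \<Longrightarrow> G i \<subseteq> G (Suc i)"
    and "F = map G [1..<CARD('n)]"
proof
  let ?n = "CARD('n)"
  define G :: "nat \<Rightarrow> ('a ^ 'n) set"
    where "G i = (if i = 0 then {0} else if i = ?n then UNIV else F ! (i - 1))" for i
  have len: "length F = ?n - 1" and sorted: "sorted_wrt (\<subset>) F"
    and sub: "\<And>i. 0 < i \<Longrightarrow> i < ?n \<Longrightarrow> vec.subspace (F ! (i - 1)) \<and> vec.dim (F ! (i - 1)) = i"
    using F by (auto simp: full_flags_def)
  show GD: "vec.subspace (G i) \<and> vec.dim (G i) = i" if "i \<le> ?n" for i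
    using sub[of i] that by (auto simp: G_def card_cart_basis)
  show "G i \<subseteq> G (Suc i)" if i: "i < ?n" for i
  proof -
    consider "i = 0" | "Suc i = ?n" | "0 < i" "Suc i < ?n" using i by linarith
    then show ?thesis
    proof cases
      case 1
      then show ?thesis
        using GD[of "Suc i"] i by (simp add: G_def[of 0] vec.subspace_0)
    next
      case 3
      then have "F ! (i - 1) \<subset> F ! i"
        using sorted len by (intro sorted_wrt_nth_less[where P = "(\<subset>)"]) auto
      then show ?thesis using 3 by (auto simp: G_def)
    qed (simp add: G_def)
  qed
  show "F = map G [1..<?n]"
    by (rule nth_equalityI) (auto simp: len G_def)
qed

lemma distance_vector_heights:
  fixes F F' :: "('a::{field,finite} ^ 'n) set list"
  assumes "F \<in> full_flags" and "F' \<in> full_flags"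
  obtains h where "h \<in> motzkin_heights CARD('n)" and "distance_vector F F' = map h [1..<CARD('n)]"
proof -
  let ?n = "CARD('n)"
  obtain G where G: "\<And>i. i \<le> ?n \<Longrightarrow> vec.subspace (G i) \<and> vec.dim (G i) = i"
      "\<And>i. i < ?n \<Longrightarrow> G i \<subseteq> G (Suc i)" and F: "F = map G [1..<?n]"
    using full_flag_extend[OF assms(1)] by metis
  obtain G' where G': "\<And>i. i \<le> ?n \<Longrightarrow> vec.subspace (G' i) \<and> vec.dim (G' i) = i"
      "\<And>i. i < ?n \<Longrightarrow> G' i \<subseteq> G' (Suc i)" and F': "F' = map G' [1..<?n]"
    using full_flag_extend[OF assms(2)] by metis
  let ?h = "\<lambda>i. injection_distance (G i) (G' i)"
  have nonneg: "0 \<le> ?h i" for i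
    by (simp add: injection_distance_def vec.dim_subset)
  have "\<bar>?h (Suc i) - ?h i\<bar> \<le> 1" if "i < ?n" for i
  proof -
    \<comment> \<open>The two subspaces are enlarged one after the other. Each enlargement adds at
      most 1 to the dimension of the intersection, so it grows by at most 2 in total.\<close>
    have "vec.dim (G (Suc i) \<inter> G' (Suc i)) + i \<le> vec.dim (G i \<inter> G' (Suc i)) + Suc i"
      using vec_dim_Int_le[of "G i" "G (Suc i)" "G' (Suc i)"] G[of i] G[of "Suc i"] G'[of "Suc i"] that
      by simp
    moreover have "vec.dim (G i \<inter> G' (Suc i)) + i \<le> vec.dim (G i \<inter> G' i) + Suc i"
      using vec_dim_Int_le[of "G' i" "G' (Suc i)" "G i"] G'[of i] G'[of "Suc i"] G[of i] that
      by (simp add: Int_commute)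
    moreover have "vec.dim (G i \<inter> G' i) \<le> vec.dim (G (Suc i) \<inter> G' (Suc i))"
      using G(2)[OF that] G'(2)[OF that] by (intro vec.dim_subset) auto
    ultimately show ?thesis
      using G(1)[of i] G(1)[of "Suc i"] that by (simp add: injection_distance_def)
  qed
  moreover have "?h 0 = 0"
  proof -
    have "vec.dim (G 0) = 0" using G(1)[of 0] by blast
    \<comment> \<open>The distance is at most the dimension of its first argument, here 0.\<close>
    then show ?thesis using nonneg[of 0] unfolding injection_distance_def by linarith
  qed
  moreover have "?h ?n = 0"
  proof -
    have "S = UNIV" if "vec.subspace S \<and> vec.dim S = ?n" for S :: "('a ^ 'n) set"
    proof -
      have "vec.span S = UNIV"
        using that vec.dim_eq_full[of S] by (simp add: vec.dimension_def card_cart_basis)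
      then show ?thesis using that by (metis vec.span_eq_iff)
    qed
    then have "G ?n = UNIV" "G' ?n = UNIV"
      using G(1)[of ?n] G'(1)[of ?n] by blast+
    then show ?thesis by (simp add: injection_distance_def)
  qed
  ultimately have "?h \<in> motzkin_heights ?n"
    using nonneg by (simp add: motzkin_heights_def)
  moreover have "distance_vector F F' = map ?h [1..<?n]"
    by (rule nth_equalityI) (auto simp: distance_vector_def F F')
  ultimately show ?thesis by (rule that)
qed

section \<open>Realizing height sequences by coordinate subspaces\<close>

text \<open>This is the combinatorial core of the converse: \<open>h i\<close> is the size of
  \<open>A i - B i\<close>, and equally of \<open>B i - A i\<close>.\<close>

lemma motzkin_heights_chains:
  assumes h: "h \<in> motzkin_heights CARD('n)"
  obtains A B :: "nat \<Rightarrow> 'n::finite set"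
  where "\<And>i. i \<le> CARD('n) \<Longrightarrow> card (A i) = i \<and> card (B i) = i \<and> int (card (A i \<inter> B i)) = int i - h i"
    and "\<And>i. i < CARD('n) \<Longrightarrow> A i \<subseteq> A (Suc i) \<and> B i \<subseteq> B (Suc i)"
proof -
  let ?n = "CARD('n)"
  \<comment> \<open>Dependent choice yields an infinite sequence; the guards
    \<open>i \<le> ?n\<close> here and \<open>i < ?n\<close> in \<open>?Q\<close> make all
    requirements vacuous once the indices are exhausted.\<close>
  let ?P = "\<lambda>i (A :: 'n set, B). i \<le> ?n \<longrightarrow>
    card A = i \<and> card B = i \<and> int (card (A \<inter> B)) = int i - h i"
  let ?Q = "\<lambda>i (A :: 'n set, B) (A', B'). i < ?n \<longrightarrow> A \<subseteq> A' \<and> B \<subseteq> B'"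
  have step: "\<bar>h (Suc i) - h i\<bar> \<le> 1" if "i < ?n" for i
    using h that by (simp add: motzkin_heights_def)
  \<comment> \<open>The path must still descend to 0, so enough fresh indices remain for each step.\<close>
  have bound: "h i \<le> int (?n - i)" if "i \<le> ?n" for i
    using that
  proof (induction rule: inc_induct)
    case base
    then show ?case using h by (simp add: motzkin_heights_def)
  next
    case (step m)
    then show ?case using \<open>\<And>i. i < ?n \<Longrightarrow> \<bar>h (Suc i) - h i\<bar> \<le> 1\<close>[of m] by simp
  qed
  have ext: "\<exists>A' B'. A \<subseteq> A' \<and> B \<subseteq> B' \<and> card A' = Suc i \<and> card B' = Suc i \<and>
      int (card (A' \<inter> B')) = int (Suc i) - h (Suc i)"
    if i: "i < ?n" and A: "card A = i" and B: "card B = i" and AB: "int (card (A \<inter> B)) = int i - h i"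
    for i and A B :: "'n set"
  proof -
    \<comment> \<open>The union has \<open>i + h i\<close> elements by inclusion-exclusion; its
      complement is the supply of fresh indices.\<close>
    have U: "int (card (- (A \<union> B))) = int ?n - int i - h i"
    proof -
      have "card A + card B = card (A \<union> B) + card (A \<inter> B)" by (rule card_Un_Int) auto
      moreover have "card (- (A \<union> B)) + card (A \<union> B) = ?n"
        by (metis Compl_partition2 card_Un_disjoint compl_inf_bot finite_class.finite_code inf_commute)
      ultimately show ?thesis using A B AB by linarith
    qed
    have "0 \<le> h (Suc i)" "h (Suc i) \<le> int (?n - Suc i)"
      using h i bound[of "Suc i"] by (auto simp: motzkin_heights_def)
    consider "h (Suc i) = h i + 1" | "h (Suc i) = h i" | "h (Suc i) = h i - 1"
      using step[OF i] by linarith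
    then show ?thesis
    proof cases
      case 1
      \<comment> \<open>The height bound at \<open>Suc i\<close> reads
        \<open>h i + 1 \<le> ?n - i - 1\<close>, which leaves two fresh indices. In the horizontal
        case the same bound leaves one.\<close>
      then have "2 \<le> card (- (A \<union> B))" using U \<open>h (Suc i) \<le> _\<close> i by linarith
      then obtain T where "T \<subseteq> - (A \<union> B)" "card T = 2"
        by (rule obtain_subset_with_card_n)
      then obtain x y where xy: "x \<in> - (A \<union> B)" "y \<in> - (A \<union> B)" "x \<noteq> y"
        unfolding card_2_iff by blast
      then have "insert x A \<inter> insert y B = A \<inter> B" by auto
      then show ?thesis
        using xy A B AB 1 by (intro exI[of _ "insert x A"] exI[of _ "insert y B"]) auto
    next
      case 2
      then have "0 < card (- (A \<union> B))" using U \<open>h (Suc i) \<le> _\<close> i by linarith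
      then obtain x where "x \<in> - (A \<union> B)" by (metis card_gt_0_iff all_not_in_conv)
      moreover have "insert x A \<inter> insert x B = insert x (A \<inter> B)" by auto
      ultimately show ?thesis
        using A B AB 2 by (intro exI[of _ "insert x A"] exI[of _ "insert x B"]) auto
    next
      case 3
      \<comment> \<open>A descent to a nonnegative height forces \<open>h i \<ge> 1\<close>, so each
        of the sets contains an index missing from the other.\<close>
      then have "card (A \<inter> B) < i"
        using AB \<open>0 \<le> h (Suc i)\<close> by linarith
      then have "A \<inter> B \<noteq> A" "A \<inter> B \<noteq> B" using A B by auto
      then obtain x y where xy: "x \<in> B - A" "y \<in> A - B" by blast
      \<comment> \<open>Both exchanged indices enter the intersection, which grows by 2 while each
        set grows by 1; hence the height drops by 1.\<close>
      then have eq: "insert x A \<inter> insert y B = insert x (insert y (A \<inter> B))" by blast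
      have "x \<noteq> y" "x \<notin> A \<inter> B" "y \<notin> A \<inter> B" "x \<notin> A" "y \<notin> B" using xy by blast+
      then have "card (insert x A) = Suc i" "card (insert y B) = Suc i"
          "int (card (insert x A \<inter> insert y B)) = int (Suc i) - h (Suc i)"
        using A B AB 3 unfolding eq by simp_all
      then show ?thesis
        by (intro exI[of _ "insert x A"] exI[of _ "insert y B"]) blast
    qed
  qed
  have "\<exists>f. \<forall>i. ?P i (f i) \<and> ?Q i (f i) (f (Suc i))"
  proof (rule dependent_nat_choice)
    show "\<exists>x. ?P 0 x"
      using h by (intro exI[of _ "({}, {})"]) (simp add: motzkin_heights_def)
    show "\<exists>y. ?P (Suc i) y \<and> ?Q i x y" if "?P i x" for x i
    proof (cases "i < ?n")
      case True
      obtain A B where x: "x = (A, B)" by (cases x)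
      then show ?thesis using ext[of i A B] that True by auto
    qed auto
  qed
  then obtain f where f: "\<And>i. ?P i (f i) \<and> ?Q i (f i) (f (Suc i))" by blast
  show ?thesis
  proof (rule that[of "fst \<circ> f" "snd \<circ> f"])
    show "card ((fst \<circ> f) i) = i \<and> card ((snd \<circ> f) i) = i \<and>
        int (card ((fst \<circ> f) i \<inter> (snd \<circ> f) i)) = int i - h i" if "i \<le> ?n" for i
      using f[of i] that by (simp add: case_prod_beta)
    show "(fst \<circ> f) i \<subseteq> (fst \<circ> f) (Suc i) \<and> (snd \<circ> f) i \<subseteq> (snd \<circ> f) (Suc i)" if "i < ?n" for i
      using f[of i] that by (simp add: case_prod_beta)
  qed
qed

text \<open>This is the span of the standard basis vectors indexed by \<open>A\<close>. Describing
  it by vanishing coordinates makes intersections immediate.\<close>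

definition coordinate_subspace :: "'n set \<Rightarrow> ('a::field ^ 'n) set" where
  "coordinate_subspace A = {x. \<forall>i. i \<notin> A \<longrightarrow> x $ i = 0}"

lemma subspace_coordinate_subspace: "vec.subspace (coordinate_subspace A)"
  by (simp add: vec.subspace_def coordinate_subspace_def)

lemma dim_coordinate_subspace: "vec.dim (coordinate_subspace A :: ('a::field ^ 'n) set) = card A"
  unfolding coordinate_subspace_def by (rule dim_substandard_cart)

lemma coordinate_subspace_Int:
  "coordinate_subspace A \<inter> coordinate_subspace B = coordinate_subspace (A \<inter> B)"
  by (auto simp: coordinate_subspace_def)

lemma coordinate_subspace_mono: "A \<subseteq> B \<Longrightarrow> coordinate_subspace A \<subseteq> coordinate_subspace B"
  by (auto simp: coordinate_subspace_def)

text \<open>Consecutive inclusions are strict because the dimensions differ; transitivity extends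
  this to all pairs.\<close>

lemma coordinate_full_flag:
  fixes A :: "nat \<Rightarrow> 'n::finite set"
  assumes card: "\<And>i. i \<le> CARD('n) \<Longrightarrow> card (A i) = i"
    and mono: "\<And>i. i < CARD('n) \<Longrightarrow> A i \<subseteq> A (Suc i)"
  shows "map (\<lambda>i. coordinate_subspace (A i)) [1..<CARD('n)] \<in>
    (full_flags :: ('a::{field,finite} ^ 'n) set list set)"
proof -
  let ?W = "\<lambda>i. coordinate_subspace (A i) :: ('a ^ 'n) set"
  have "?W i \<subset> ?W (Suc i)" if "i < CARD('n)" for i
  proof -
    have "vec.dim (?W i) \<noteq> vec.dim (?W (Suc i))"
      using that by (simp add: dim_coordinate_subspace card)
    then have "?W i \<noteq> ?W (Suc i)" by auto
    then show ?thesis using coordinate_subspace_mono[OF mono[OF that]] by blast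
  qed
  then have "sorted_wrt (\<subset>) (map ?W [1..<CARD('n)])"
    by (subst sorted_wrt_iff_nth_Suc_transp) (auto simp: transp_def)
  then show ?thesis
    by (auto simp: full_flags_def subspace_coordinate_subspace dim_coordinate_subspace card)
qed

text \<open>For coordinate subspaces, dimensions of intersections are cardinalities of index sets,
  so the two chains of sets yield the required flags over every finite field.\<close>

lemma heights_distance_vector:
  assumes h: "h \<in> motzkin_heights CARD('n::finite)"
  obtains F F' :: "('a::{field,finite} ^ 'n) set list"
  where "F \<in> full_flags" and "F' \<in> full_flags" and "distance_vector F F' = map h [1..<CARD('n)]"
proof -
  obtain A B :: "nat \<Rightarrow> 'n set"
    where card: "\<And>i. i \<le> CARD('n) \<Longrightarrow>
        card (A i) = i \<and> card (B i) = i \<and> int (card (A i \<inter> B i)) = int i - h i"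
      and mono: "\<And>i. i < CARD('n) \<Longrightarrow> A i \<subseteq> A (Suc i) \<and> B i \<subseteq> B (Suc i)"
    using motzkin_heights_chains[OF h] by metis
  let ?F = "\<lambda>A. map (\<lambda>i. coordinate_subspace (A i)) [1..<CARD('n)] :: ('a ^ 'n) set list"
  have "?F A \<in> full_flags" "?F B \<in> full_flags"
    using card mono by (intro coordinate_full_flag; blast)+
  moreover have "distance_vector (?F A) (?F B) = map h [1..<CARD('n)]"
    by (rule nth_equalityI)
      (auto simp: distance_vector_def injection_distance_def
        coordinate_subspace_Int dim_coordinate_subspace card)
  ultimately show ?thesis by (rule that)
qed

section \<open>Equality of the two counts\<close>

text \<open>The right-hand side involves the space only through its dimension, so the set of
  distance vectors is the same for all \<open>q\<close>.\<close>

lemma distance_vectors_eq_heights: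
  "distance_vectors TYPE('a::{field,finite} ^ 'n) d =
    {map h [1..<CARD('n)] | h. h \<in> motzkin_heights CARD('n) \<and> (\<Sum>i=1..<CARD('n). h i) = d}"
proof -
  have sum: "sum_list (map h [1..<CARD('n)]) = (\<Sum>i=1..<CARD('n). h i)" for h :: "nat \<Rightarrow> int"
    by (simp add: sum_list_distinct_conv_sum_set)
  show ?thesis
  proof (intro equalityI subsetI)
    fix l assume "l \<in> distance_vectors TYPE('a ^ 'n) d"
    then obtain F F' :: "('a ^ 'n) set list"
      where F: "F \<in> full_flags" "F' \<in> full_flags" "l = distance_vector F F'" "sum_list l = d"
      by (auto simp: distance_vectors_def flag_distance_def)
    from F(1,2) obtain h where "h \<in> motzkin_heights CARD('n)" "distance_vector F F' = map h [1..<CARD('n)]"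
      by (rule distance_vector_heights)
    then show "l \<in> {map h [1..<CARD('n)] | h.
        h \<in> motzkin_heights CARD('n) \<and> (\<Sum>i=1..<CARD('n). h i) = d}"
      using F(3,4) sum by auto
  next
    fix l assume "l \<in> {map h [1..<CARD('n)] | h.
        h \<in> motzkin_heights CARD('n) \<and> (\<Sum>i=1..<CARD('n). h i) = d}"
    then obtain h where h: "h \<in> motzkin_heights CARD('n)" "l = map h [1..<CARD('n)]"
        "(\<Sum>i=1..<CARD('n). h i) = d" by blast
    from h(1) obtain F F' :: "('a ^ 'n) set list"
      where F: "F \<in> full_flags" "F' \<in> full_flags" "distance_vector F F' = map h [1..<CARD('n)]"
      by (rule heights_distance_vector)
    then have "flag_distance F F' = d" using h(3) sum by (simp add: flag_distance_def)
    then show "l \<in> distance_vectors TYPE('a ^ 'n) d"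
      using F h(2) unfolding distance_vectors_def by (smt (verit) mem_Collect_eq)
  qed
qed

text \<open>Both sides count the same set of lists of interior heights with sum
  \<open>d\<close>.\<close>

theorem corollary4p15:
  fixes q n d :: nat
  assumes "primepow q"
    and "CARD('a::{field,finite}) = q"
    and "CARD('n::finite) = n"
    and "n \<ge> 2"
    and "d \<le> n\<^sup>2 div 4"
  shows "card (distance_vectors TYPE('a ^ 'n) (int d)) = motzkin_count n d"
  by (simp add: distance_vectors_eq_heights motzkin_count_eq_card_heights assms(3))

end
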